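(* Let $G$ be a finite group, and let $H, K\leq G$ be conjugate, non-normal subgroups of index $n$ in $G$. Then $$\frac{(n-1)!}{(n-1)^{n-1}} \leq P_G(H, K) \leq \frac{1}{2},$$ and these bounds are best possible (there are such $G,H,K$ for which the lower bound is attained, and such $G,H,K$ for which the upper bound is attained). In particular, for $n = 3$ we have $P_G(H, K) = 1/2$.
   Context: For subgroups $H,K$ of a finite group $G$ with $(G:H)=n=(G:K)$, $\mathrm{DT}_G(H,K)$ is the set of all left transversals for $H$ in $G$ (sets containing exactly one element of each left coset $gH$) which are also right transversals for $K$ in $G$ (contain exactly one element of each right coset $Kg$), and $P_G(H,K) := |\mathrm{DT}_G(H,K)|/|H|^n$. *)

theory Defs
  imports Complex_Main "HOL-Algebra.Left_Coset"
begin

definition subgroup_index :: "('a, 'b) monoid_scheme \<Rightarrow> 'a set \<Rightarrow> nat" where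
  "subgroup_index G H = card (lcosets\<^bsub>G\<^esub> H)"

definition left_transversal :: "('a, 'b) monoid_scheme \<Rightarrow> 'a set \<Rightarrow> 'a set \<Rightarrow> bool" where
  "left_transversal G H T \<longleftrightarrow>
     T \<subseteq> carrier G \<and> (\<forall>C \<in> lcosets\<^bsub>G\<^esub> H. \<exists>!t. t \<in> T \<and> t \<in> C)"

definition right_transversal :: "('a, 'b) monoid_scheme \<Rightarrow> 'a set \<Rightarrow> 'a set \<Rightarrow> bool" where
  "right_transversal G K T \<longleftrightarrow>
     T \<subseteq> carrier G \<and> (\<forall>C \<in> rcosets\<^bsub>G\<^esub> K. \<exists>!t. t \<in> T \<and> t \<in> C)"

definition DT :: "('a, 'b) monoid_scheme \<Rightarrow> 'a set \<Rightarrow> 'a set \<Rightarrow> 'a set set" where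
  "DT G H K = {T. left_transversal G H T \<and> right_transversal G K T}"

definition P_DT :: "('a, 'b) monoid_scheme \<Rightarrow> 'a set \<Rightarrow> 'a set \<Rightarrow> real" where
  "P_DT G H K = real (card (DT G H K)) / real (card H) ^ subgroup_index G H"

definition conjugate_subgroups :: "('a, 'b) monoid_scheme \<Rightarrow> 'a set \<Rightarrow> 'a set \<Rightarrow> bool" where
  "conjugate_subgroups G H K \<longleftrightarrow>
     (\<exists>g \<in> carrier G. K = g <#\<^bsub>G\<^esub> (H #>\<^bsub>G\<^esub> inv\<^bsub>G\<^esub> g))"

definition conj_nonnormal_pair ::
  "('a, 'b) monoid_scheme \<Rightarrow> 'a set \<Rightarrow> 'a set \<Rightarrow> nat \<Rightarrow> bool" where
  "conj_nonnormal_pair G H K n \<longleftrightarrow>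
     group G \<and> finite (carrier G) \<and>
     subgroup H G \<and> subgroup K G \<and> conjugate_subgroups G H K \<and>
     \<not> H \<lhd> G \<and> \<not> K \<lhd> G \<and>
     subgroup_index G H = n \<and> subgroup_index G K = n"

end

theory Submission
  imports Defs "HOL-Library.FuncSet"
begin

text \<open>The carrier of \<open>G\<close> splits into double cosets \<open>KgH\<close>, and a double transversal is an independent
  choice of one in each \<open>KgH\<close>. If \<open>KgH\<close> contains \<open>d\<close> left cosets of \<open>H\<close>, it also contains \<open>d\<close> right
  cosets of \<open>K\<close>, and each of these left cosets meets each of these right cosets in \<open>|H|/d\<close> elements,
  which gives \<open>d! (|H|/d)\<^sup>d\<close> choices. Hence \<open>P\<close> is the product of the numbers \<open>d!/d\<^sup>d\<close>.
  If \<open>K = gHg\<^sup>-\<^sup>1\<close>, then \<open>d = 1\<close> for \<open>KgH\<close>, so the remaining \<open>d\<close> sum to \<open>n - 1\<close>; since \<open>d!/d\<^sup>d\<close> is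
  submultiplicative in \<open>d\<close>, this gives the lower bound. If \<open>H\<close> is not normal, then some \<open>d\<close> is at
  least 2, which gives the upper bound. The two bounds agree for \<open>n = 3\<close>, so a subgroup of order 2
  in the symmetric group on three letters attains both.\<close>

section \<open>Counting common transversals of two partitions\<close>

text \<open>The functions \<open>l\<close> and \<open>r\<close> label each point by its class in two
  partitions. Working with labels instead of classes allows restriction to any part \<open>X\<close>
  of the ground set.\<close>

definition double_transversals :: "('x \<Rightarrow> 'l) \<Rightarrow> ('x \<Rightarrow> 'r) \<Rightarrow> 'x set \<Rightarrow> 'x set set" where
  "double_transversals l r X = {T. T \<subseteq> X \<and> bij_betw l T (l ` X) \<and> bij_betw r T (r ` X)}"

section \<open>Transversals of a union of blocks without common labels\<close>

lemma disjoint_Un_eq_iff: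
  assumes "A \<subseteq> C" "B \<subseteq> D" "C \<inter> D = {}"
  shows "A \<union> B = C \<union> D \<longleftrightarrow> A = C \<and> B = D"
  using assms by blast

lemma bij_betw_image_Un:
  assumes "f ` X \<inter> f ` Y = {}" "T \<subseteq> X" "U \<subseteq> Y"
  shows "bij_betw f (T \<union> U) (f ` (X \<union> Y)) \<longleftrightarrow> bij_betw f T (f ` X) \<and> bij_betw f U (f ` Y)"
proof -
  have sub: "f ` T \<subseteq> f ` X" "f ` U \<subseteq> f ` Y" using assms by (simp_all add: image_mono)
  have "f ` (T - U) \<inter> f ` (U - T) = {}" using assms by blast
  then have "inj_on f (T \<union> U) \<longleftrightarrow> inj_on f T \<and> inj_on f U" by (simp add: inj_on_Un)
  moreover have "f ` T \<union> f ` U = f ` X \<union> f ` Y \<longleftrightarrow> f ` T = f ` X \<and> f ` U = f ` Y"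
    using sub assms(1) by (intro disjoint_Un_eq_iff)
  ultimately show ?thesis by (auto simp: bij_betw_def image_Un)
qed

text \<open>No label occurs on both sides, so bijectivity of each labelling can be tested on the two
  parts separately. Intersecting with \<open>X\<close> and \<open>Y\<close> therefore inverts the
  union map on pairs of transversals.\<close>

lemma card_double_transversals_Un:
  assumes l: "l ` X \<inter> l ` Y = {}" and r: "r ` X \<inter> r ` Y = {}"
  shows "card (double_transversals l r (X \<union> Y)) =
    card (double_transversals l r X) * card (double_transversals l r Y)"
proof -
  have XY: "X \<inter> Y = {}" using l by blast
  have "bij_betw (\<lambda>(T, U). T \<union> U) (double_transversals l r X \<times> double_transversals l r Y)
    (double_transversals l r (X \<union> Y))"
  proof (rule bij_betw_byWitness[where f' = "\<lambda>T. (T \<inter> X, T \<inter> Y)"])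
    show "(\<lambda>(T, U). T \<union> U) ` (double_transversals l r X \<times> double_transversals l r Y)
      \<subseteq> double_transversals l r (X \<union> Y)"
    proof clarify
      fix T U assume "T \<in> double_transversals l r X" "U \<in> double_transversals l r Y"
      then show "T \<union> U \<in> double_transversals l r (X \<union> Y)"
        unfolding double_transversals_def
        using bij_betw_image_Un[OF l, of T U] bij_betw_image_Un[OF r, of T U] by auto
    qed
    show "(\<lambda>T. (T \<inter> X, T \<inter> Y)) ` double_transversals l r (X \<union> Y)
      \<subseteq> double_transversals l r X \<times> double_transversals l r Y"
    proof clarify
      fix T assume T: "T \<in> double_transversals l r (X \<union> Y)"
      then have "T = (T \<inter> X) \<union> (T \<inter> Y)" by (auto simp: double_transversals_def)
      with T have "bij_betw l ((T \<inter> X) \<union> (T \<inter> Y)) (l ` (X \<union> Y))"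
        "bij_betw r ((T \<inter> X) \<union> (T \<inter> Y)) (r ` (X \<union> Y))"
        by (simp_all add: double_transversals_def)
      then show "T \<inter> X \<in> double_transversals l r X \<and> T \<inter> Y \<in> double_transversals l r Y"
        using bij_betw_image_Un[OF l, of "T \<inter> X" "T \<inter> Y"]
          bij_betw_image_Un[OF r, of "T \<inter> X" "T \<inter> Y"]
        by (simp add: double_transversals_def)
    qed
  qed (use XY in \<open>auto simp: double_transversals_def\<close>)
  then show ?thesis
    by (simp only: bij_betw_same_card[symmetric] card_cartesian_product)
qed

lemma card_double_transversals_Union:
  assumes "finite \<D>"
    and "\<And>D E. D \<in> \<D> \<Longrightarrow> E \<in> \<D> \<Longrightarrow> D \<noteq> E \<Longrightarrow> l ` D \<inter> l ` E = {} \<and> r ` D \<inter> r ` E = {}"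
  shows "card (double_transversals l r (\<Union>\<D>)) = (\<Prod>D\<in>\<D>. card (double_transversals l r D))"
  using assms
proof (induction \<D>)
  case empty
  have "double_transversals l r {} = {{}}" by (auto simp: double_transversals_def bij_betw_def)
  then show ?case by simp
next
  case (insert D \<D>)
  have "l ` D \<inter> l ` E = {} \<and> r ` D \<inter> r ` E = {}" if "E \<in> \<D>" for E
    using insert.prems[of D E] insert.hyps that by blast
  then have "l ` D \<inter> l ` \<Union>\<D> = {}" "r ` D \<inter> r ` \<Union>\<D> = {}"
    by (auto simp: image_Union Int_UN_distrib)
  then have "card (double_transversals l r (D \<union> \<Union>\<D>)) =
    card (double_transversals l r D) * card (double_transversals l r (\<Union>\<D>))"
    by (rule card_double_transversals_Un)
  with insert show ?case by simp
qed

section \<open>Blocks in which all pairs of labels are equally frequent\<close>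

text \<open>Values are chosen one left label at a time: after \<open>i\<close> choices exactly
  \<open>i\<close> right labels are used up, and each remaining one offers \<open>m\<close> points.
  Letting \<open>L\<close> range over subsets of the left labels makes the induction
  possible.\<close>

lemma card_injective_sections:
  fixes l :: "'x \<Rightarrow> 'l" and r :: "'x \<Rightarrow> 'r"
  assumes X: "finite X" and L: "finite L" "L \<subseteq> l ` X"
    and m: "\<And>a b. a \<in> l ` X \<Longrightarrow> b \<in> r ` X \<Longrightarrow> card {x \<in> X. l x = a \<and> r x = b} = m"
  shows "card {s \<in> (\<Pi>\<^sub>E a\<in>L. {x \<in> X. l x = a}). inj_on (r \<circ> s) L} =
    (\<Prod>i<card L. m * (card (r ` X) - i))"
  using L
proof (induction L)
  case empty
  have "{s. s \<in> (\<Pi>\<^sub>E a\<in>{}. {x \<in> X. l x = a}) \<and> inj_on (r \<circ> s) {}} = {\<lambda>_. undefined}" by auto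
  then show ?case by (simp only: card.empty lessThan_0 prod.empty) simp
next
  case (insert a L)
  define S where "S = {s \<in> (\<Pi>\<^sub>E a\<in>L. {x \<in> X. l x = a}). inj_on (r \<circ> s) L}"
  \<comment> \<open>The points that can extend the partial section \<open>s\<close> at the new label
    \<open>a\<close>.\<close>
  define A where "A s = {x \<in> X. l x = a \<and> r x \<notin> (r \<circ> s) ` L}" for s
  have aX: "a \<in> l ` X" using insert by auto
  have finS: "finite S" unfolding S_def
    by (rule finite_subset[OF _ finite_PiE[of L "\<lambda>a. {x \<in> X. l x = a}"]])
      (use insert X in auto)
  have cA: "card (A s) = m * (card (r ` X) - card L)" if s: "s \<in> S" for s
  proof -
    have sub: "(r \<circ> s) ` L \<subseteq> r ` X" using s by (auto simp: S_def PiE_iff)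
    have "{x \<in> X. l x = a \<and> r x \<notin> R} = (\<Union>b\<in>r ` X - R. {x \<in> X. l x = a \<and> r x = b})" for R
      by auto
    then have "A s = (\<Union>b\<in>r ` X - (r \<circ> s) ` L. {x \<in> X. l x = a \<and> r x = b})"
      unfolding A_def .
    then have "card (A s) = (\<Sum>b\<in>r ` X - (r \<circ> s) ` L. card {x \<in> X. l x = a \<and> r x = b})"
      using X by (simp only:) (rule card_UN_disjoint, auto)
    also have "\<dots> = (\<Sum>b\<in>r ` X - (r \<circ> s) ` L. m)"
      by (rule sum.cong) (use m aX in auto)
    also have "\<dots> = m * (card (r ` X) - card ((r \<circ> s) ` L))"
      using sub X by (simp add: card_Diff_subset insert.hyps)
    also have "card ((r \<circ> s) ` L) = card L"
      using s by (intro card_image) (simp add: S_def)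
    finally show ?thesis .
  qed
  have "bij_betw (\<lambda>(s, x). s(a := x)) (SIGMA s:S. A s)
    {s \<in> (\<Pi>\<^sub>E a\<in>insert a L. {x \<in> X. l x = a}). inj_on (r \<circ> s) (insert a L)}"
  \<comment> \<open>Removing \<open>a\<close> from the domain resets the value there to
    \<open>undefined\<close>, as membership in \<open>PiE\<close> over \<open>L\<close>
    demands.\<close>
  proof (rule bij_betw_byWitness[where f' = "\<lambda>s. (s(a := undefined), s a)"])
    show "\<forall>p\<in>SIGMA s:S. A s. (((\<lambda>(s, x). s(a := x)) p)(a := undefined), (\<lambda>(s, x). s(a := x)) p a) = p"
      using insert.hyps by (auto simp: S_def PiE_def extensional_def fun_eq_iff)
    have im: "(r \<circ> s(a := x)) ` L = (r \<circ> s) ` L" "inj_on (r \<circ> s(a := x)) L = inj_on (r \<circ> s) L" for s x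
      using insert.hyps by (auto simp: inj_on_def intro!: image_cong)
    have La: "L - {a} = L" using insert.hyps by simp
    show "(\<lambda>(s, x). s(a := x)) ` (SIGMA s:S. A s) \<subseteq>
      {s \<in> (\<Pi>\<^sub>E a\<in>insert a L. {x \<in> X. l x = a}). inj_on (r \<circ> s) (insert a L)}"
    proof clarify
      fix s x assume s: "s \<in> S" and x: "x \<in> A s"
      have "inj_on (r \<circ> s(a := x)) L" "(r \<circ> s(a := x)) a \<notin> (r \<circ> s(a := x)) ` L"
        unfolding im using s x by (simp_all add: S_def A_def)
      then have "inj_on (r \<circ> s(a := x)) (insert a L)" unfolding inj_on_insert La by simp
      moreover have "s(a := x) \<in> (\<Pi>\<^sub>E a\<in>insert a L. {x \<in> X. l x = a})"
        using s x by (auto simp: S_def A_def PiE_iff extensional_def)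
      ultimately show "s(a := x) \<in> (\<Pi>\<^sub>E a\<in>insert a L. {x \<in> X. l x = a}) \<and>
        inj_on (r \<circ> s(a := x)) (insert a L)" by simp
    qed
    show "(\<lambda>s. (s(a := undefined), s a)) `
      {s \<in> (\<Pi>\<^sub>E a\<in>insert a L. {x \<in> X. l x = a}). inj_on (r \<circ> s) (insert a L)} \<subseteq> (SIGMA s:S. A s)"
    proof (rule image_subsetI)
      fix s assume s: "s \<in> {s \<in> (\<Pi>\<^sub>E a\<in>insert a L. {x \<in> X. l x = a}). inj_on (r \<circ> s) (insert a L)}"
      then have "inj_on (r \<circ> s) L" "r (s a) \<notin> (r \<circ> s) ` L"
        unfolding mem_Collect_eq inj_on_insert La by simp_all
      then show "(s(a := undefined), s a) \<in> (SIGMA s:S. A s)"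
        using s insert.hyps by (auto simp: S_def A_def im PiE_iff extensional_def simp del: image_comp)
    qed
  qed auto
  then have "card {s \<in> (\<Pi>\<^sub>E a\<in>insert a L. {x \<in> X. l x = a}). inj_on (r \<circ> s) (insert a L)}
    = card (SIGMA s:S. A s)" by (rule bij_betw_same_card[symmetric])
  also have "\<dots> = (\<Sum>s\<in>S. card (A s))"
    using finS X by (intro card_SigmaI) (auto simp: A_def)
  also have "\<dots> = card S * (m * (card (r ` X) - card L))" using cA by simp
  also have "card S = (\<Prod>i<card L. m * (card (r ` X) - i))"
    unfolding S_def by (rule insert.IH) (use insert.prems in auto)
  finally show ?case using insert.hyps by simp
qed

lemma prod_descending_multiples: "(\<Prod>i<d. m * (d - i)) = fact d * m ^ d" for d m :: nat
proof -
  have "(\<Prod>i<d. d - i) = fact d"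
    using prod.nat_diff_reindex[of Suc d] by (simp add: fact_prod_Suc atLeast0LessThan Suc_diff_Suc)
  then show ?thesis by (simp add: prod.distrib)
qed

text \<open>A double transversal \<open>T\<close> is the image of exactly one section of
  \<open>l\<close>, the inverse of \<open>l\<close> on \<open>T\<close>. The sections that arise are
  those for which \<open>r\<close> stays injective, and these have just been counted.\<close>

lemma card_double_transversals_complete:
  fixes l :: "'x \<Rightarrow> 'l" and r :: "'x \<Rightarrow> 'r"
  assumes X: "finite X" and d: "card (l ` X) = d" "card (r ` X) = d"
    and m: "\<And>a b. a \<in> l ` X \<Longrightarrow> b \<in> r ` X \<Longrightarrow> card {x \<in> X. l x = a \<and> r x = b} = m"
  shows "card (double_transversals l r X) = fact d * m ^ d"
proof -
  let ?S = "{s \<in> (\<Pi>\<^sub>E a\<in>l ` X. {x \<in> X. l x = a}). inj_on (r \<circ> s) (l ` X)}"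
  have "bij_betw (\<lambda>s. s ` l ` X) ?S (double_transversals l r X)"
  proof (rule bij_betw_byWitness[where f' = "\<lambda>T. restrict (the_inv_into T l) (l ` X)"])
    show "\<forall>s\<in>?S. restrict (the_inv_into (s ` l ` X) l) (l ` X) = s"
    proof
      fix s assume s: "s \<in> ?S"
      then have ls: "l (s a) = a" if "a \<in> l ` X" for a using that by (auto simp: PiE_iff)
      have inj: "inj_on l (s ` l ` X)" using ls by (auto simp: inj_on_def)
      show "restrict (the_inv_into (s ` l ` X) l) (l ` X) = s"
      proof (rule extensionalityI[of _ "l ` X"])
        show "s \<in> extensional (l ` X)" using s by (auto simp: PiE_def)
        fix a assume a: "a \<in> l ` X"
        then have "the_inv_into (s ` l ` X) l (l (s a)) = s a"
          by (intro the_inv_into_f_f[OF inj]) auto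
        then show "restrict (the_inv_into (s ` l ` X) l) (l ` X) a = s a" using a ls by simp
      qed simp
    qed
    show "\<forall>T\<in>double_transversals l r X. restrict (the_inv_into T l) (l ` X) ` l ` X = T"
    proof
      fix T assume "T \<in> double_transversals l r X"
      then have "inj_on l T" "l ` T = l ` X" by (auto simp: double_transversals_def bij_betw_def)
      then show "restrict (the_inv_into T l) (l ` X) ` l ` X = T"
        using the_inv_into_onto[of l T] by simp
    qed
    show "(\<lambda>s. s ` l ` X) ` ?S \<subseteq> double_transversals l r X"
    proof (rule image_subsetI)
      fix s assume s: "s \<in> ?S"
      then have ls: "l (s a) = a" "s a \<in> X" if "a \<in> l ` X" for a using that by (auto simp: PiE_iff)
      have sub: "s ` l ` X \<subseteq> X" using ls by blast
      have inj: "inj_on (r \<circ> s) (l ` X)" using s by simp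
      have "inj_on l (s ` l ` X)" using ls by (auto simp: inj_on_def)
      moreover have "l ` s ` l ` X = l ` X" using ls by (auto simp: image_iff)
      moreover have "inj_on r (s ` l ` X)" using inj by (rule inj_on_imageI)
      moreover have "r ` s ` l ` X = r ` X"
      \<comment> \<open>Injectivity suffices for surjectivity because both labellings take the same
        number \<open>d\<close> of values.\<close>
      proof (rule card_subset_eq)
        have "card ((r \<circ> s) ` l ` X) = card (l ` X)" using inj by (rule card_image)
        then show "card (r ` s ` l ` X) = card (r ` X)" using d by (simp only: image_comp comp_assoc)
      qed (use X sub in auto)
      ultimately show "s ` l ` X \<in> double_transversals l r X"
        using sub by (simp add: double_transversals_def bij_betw_def)
    qed
    show "(\<lambda>T. restrict (the_inv_into T l) (l ` X)) ` double_transversals l r X \<subseteq> ?S"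
    proof (rule image_subsetI)
      fix T assume "T \<in> double_transversals l r X"
      then have T: "T \<subseteq> X" "inj_on l T" "l ` T = l ` X" "inj_on r T"
        by (auto simp: double_transversals_def bij_betw_def)
      have inv: "the_inv_into T l a \<in> T" "l (the_inv_into T l a) = a" if "a \<in> l ` X" for a
        using that T(3) the_inv_into_into[OF T(2), of a T] f_the_inv_into_f[OF T(2), of a] by auto
      have "inj_on (r \<circ> restrict (the_inv_into T l) (l ` X)) (l ` X)"
      proof (rule inj_onI)
        fix a b assume a: "a \<in> l ` X" and b: "b \<in> l ` X"
          and "(r \<circ> restrict (the_inv_into T l) (l ` X)) a = (r \<circ> restrict (the_inv_into T l) (l ` X)) b"
        then have "the_inv_into T l a = the_inv_into T l b"
          using inv(1)[OF a] inv(1)[OF b] by (intro inj_onD[OF T(4)]) simp_all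
        then show "a = b" using inv(2) a b by metis
      qed
      then show "restrict (the_inv_into T l) (l ` X) \<in> ?S"
        using inv T(1) by (auto simp: PiE_iff)
    qed
  qed
  then have "card (double_transversals l r X) = card ?S"
    by (rule bij_betw_same_card[symmetric])
  also have "\<dots> = (\<Prod>i<card (l ` X). m * (card (r ` X) - i))"
    by (rule card_injective_sections[OF X _ _ m]) (use X in auto)
  finally show ?thesis by (simp only: d prod_descending_multiples)
qed

section \<open>The numbers \<open>d!/d\<^sup>d\<close>\<close>

text \<open>This is the proportion of bijections among the self-maps of a set with \<open>d\<close>
  elements; at \<open>d = 0\<close> it is 1, since \<open>0 ^ 0 = 1\<close>.\<close>

definition fact_ratio :: "nat \<Rightarrow> real" where
  "fact_ratio d = fact d / real d ^ d"

lemma fact_ratio_pos: "0 < fact_ratio d"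
  by (cases d) (auto simp: fact_ratio_def)

lemma fact_ratio_le_1: "fact_ratio d \<le> 1"
proof -
  have "0 < real d ^ d" by (cases d) auto
  then show ?thesis using fact_le_power[of d, where 'a = real] by (simp add: fact_ratio_def)
qed

text \<open>The binomial coefficient times \<open>a\<^sup>a b\<^sup>b\<close> is a single term in the expansion of \<open>(a + b)\<^bsup>a + b\<^esup>\<close>.\<close>

lemma fact_ratio_add_le: "fact_ratio (a + b) \<le> fact_ratio a * fact_ratio b"
proof -
  have "real ((a + b) choose a) * real a ^ a * real b ^ (a + b - a)
    \<le> (\<Sum>k\<le>a + b. real ((a + b) choose k) * real a ^ k * real b ^ (a + b - k))"
    by (rule member_le_sum[of a]) auto
  also have "\<dots> = (real a + real b) ^ (a + b)" by (rule binomial_ring[symmetric])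
  finally have *: "fact (a + b) / (fact a * fact b) * real a ^ a * real b ^ b \<le> real (a + b) ^ (a + b)"
    by (simp add: binomial_fact)
  have pos: "0 < real d ^ d" for d :: nat by (cases d) auto
  show ?thesis unfolding fact_ratio_def times_divide_times_eq
    using * pos[of a] pos[of b] pos[of "a + b"]
    by (simp add: divide_le_eq pos_le_divide_eq field_simps del: of_nat_add power_add)
qed

lemma fact_ratio_sum_le: "finite I \<Longrightarrow> fact_ratio (\<Sum>i\<in>I. d i) \<le> (\<Prod>i\<in>I. fact_ratio (d i))"
proof (induction I rule: finite_induct)
  case (insert i I)
  have "fact_ratio (d i + sum d I) \<le> fact_ratio (d i) * fact_ratio (sum d I)"
    by (rule fact_ratio_add_le)
  also have "\<dots> \<le> fact_ratio (d i) * (\<Prod>i\<in>I. fact_ratio (d i))"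
    using insert fact_ratio_pos[of "d i"] by simp
  finally show ?case using insert.hyps by simp
qed (simp add: fact_ratio_def)

text \<open>Submultiplicativity splits off a summand 2, which contributes exactly 1/2; the other
  factor is at most 1.\<close>

lemma fact_ratio_le_half: "2 \<le> d \<Longrightarrow> fact_ratio d \<le> 1 / 2"
proof -
  assume "2 \<le> d"
  then obtain b where d: "d = 2 + b" by (metis le_Suc_ex)
  have "fact_ratio 2 = 1 / 2" by (simp add: fact_ratio_def)
  then have "fact_ratio d \<le> 1 / 2 * fact_ratio b" using fact_ratio_add_le[of 2 b] by (simp only: d)
  then show ?thesis using fact_ratio_le_1[of b] by linarith
qed

section \<open>Double cosets\<close>

definition double_coset :: "('a, 'b) monoid_scheme \<Rightarrow> 'a set \<Rightarrow> 'a \<Rightarrow> 'a set \<Rightarrow> 'a set" where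
  "double_coset G K g H = {k \<otimes>\<^bsub>G\<^esub> g \<otimes>\<^bsub>G\<^esub> h | k h. k \<in> K \<and> h \<in> H}"

lemma lcosets_eq_image: "lcosets\<^bsub>G\<^esub> H = (\<lambda>x. x <#\<^bsub>G\<^esub> H) ` carrier G"
  by (auto simp: LCOSETS_def)

lemma rcosets_eq_image: "rcosets\<^bsub>G\<^esub> K = (\<lambda>x. K #>\<^bsub>G\<^esub> x) ` carrier G"
  by (auto simp: RCOSETS_def)

text \<open>The second hypothesis says that \<open>f x\<close> is the class of \<open>x\<close> in a
  partition of \<open>X\<close>, so lying in a class means having it as label. It serves for left
  and right cosets alike.\<close>

lemma ex1_mem_iff_bij_betw:
  assumes "T \<subseteq> X" and "\<And>x y. x \<in> X \<Longrightarrow> y \<in> X \<Longrightarrow> y \<in> f x \<longleftrightarrow> f y = f x"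
  shows "(\<forall>C\<in>f ` X. \<exists>!t. t \<in> T \<and> t \<in> C) \<longleftrightarrow> bij_betw f T (f ` X)"
proof
  assume L: "\<forall>C\<in>f ` X. \<exists>!t. t \<in> T \<and> t \<in> C"
  have "inj_on f T"
  proof (rule inj_onI)
    fix s t assume st: "s \<in> T" "t \<in> T" "f s = f t"
    then have "s \<in> f s" "t \<in> f s" using assms by auto
    moreover have "\<exists>!t. t \<in> T \<and> t \<in> f s" using L st(1) assms(1) by auto
    ultimately show "s = t" using st by blast
  qed
  moreover have "f x \<in> f ` T" if x: "x \<in> X" for x
  proof -
    obtain t where "t \<in> T" "t \<in> f x" using L x by blast
    then show ?thesis using assms x by (metis image_eqI subsetD)
  qed
  ultimately show "bij_betw f T (f ` X)" using assms(1) by (auto simp: bij_betw_def)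
next
  assume R: "bij_betw f T (f ` X)"
  show "\<forall>C\<in>f ` X. \<exists>!t. t \<in> T \<and> t \<in> C"
  proof
    fix C assume "C \<in> f ` X"
    then obtain x where x: "x \<in> X" "C = f x" by blast
    have mem: "t \<in> C \<longleftrightarrow> f t = C" if "t \<in> T" for t using that assms x by auto
    obtain t where t: "t \<in> T" "f t = C" using R x by (metis bij_betw_imp_surj_on image_iff)
    show "\<exists>!t. t \<in> T \<and> t \<in> C"
    proof (rule ex1I)
      show "t \<in> T \<and> t \<in> C" using t mem by blast
      fix s assume "s \<in> T \<and> s \<in> C"
      then show "s = t" using t mem R by (metis bij_betw_imp_inj_on inj_onD)
    qed
  qed
qed

section \<open>Cosets as labels of group elements\<close>

context group
begin

text \<open>Together with \<open>m_assoc\<close> these right-associated forms let the simplifier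
  cancel an inverse pair inside a longer product.\<close>

lemma inv_cancel:
  assumes "x \<in> carrier G" "y \<in> carrier G"
  shows "inv x \<otimes> (x \<otimes> y) = y" "x \<otimes> (inv x \<otimes> y) = y"
  using assms by (simp_all flip: m_assoc)

lemma mem_l_coset_iff:
  assumes "subgroup H G" "x \<in> carrier G" "y \<in> carrier G"
  shows "y \<in> x <# H \<longleftrightarrow> y <# H = x <# H"
  using assms lcos_self l_repr_independence by metis

lemma mem_r_coset_iff:
  assumes "subgroup K G" "x \<in> carrier G" "y \<in> carrier G"
  shows "y \<in> K #> x \<longleftrightarrow> K #> y = K #> x"
  using assms rcos_self repr_independence by metis

lemma DT_eq_double_transversals:
  assumes "subgroup H G" "subgroup K G"
  shows "DT G H K = double_transversals (\<lambda>x. x <# H) (\<lambda>x. K #> x) (carrier G)"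
proof -
  have "left_transversal G H T \<longleftrightarrow>
    T \<subseteq> carrier G \<and> bij_betw (\<lambda>x. x <# H) T ((\<lambda>x. x <# H) ` carrier G)" for T
    unfolding left_transversal_def lcosets_eq_image
    by (rule conj_cong[OF refl], rule ex1_mem_iff_bij_betw) (simp_all add: mem_l_coset_iff[OF assms(1)])
  moreover have "right_transversal G K T \<longleftrightarrow>
    T \<subseteq> carrier G \<and> bij_betw (\<lambda>x. K #> x) T ((\<lambda>x. K #> x) ` carrier G)" for T
    unfolding right_transversal_def rcosets_eq_image
    by (rule conj_cong[OF refl], rule ex1_mem_iff_bij_betw) (simp_all add: mem_r_coset_iff[OF assms(2)])
  ultimately show ?thesis unfolding DT_def double_transversals_def by auto
qed

end

section \<open>Double cosets for two subgroups of equal order\<close>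

locale double_coset_pair = group +
  fixes H K
  assumes H: "subgroup H G" and K: "subgroup K G" and fin: "finite (carrier G)"
    and card_eq: "card H = card K"
begin

abbreviation dc where "dc g \<equiv> double_coset G K g H"
abbreviation lc where "lc x \<equiv> x <# H"
abbreviation rc where "rc x \<equiv> K #> x"

lemmas H_carrier [simp] = subgroup.mem_carrier[OF H] and K_carrier [simp] = subgroup.mem_carrier[OF K]
lemmas H_closed [simp] = subgroup.one_closed[OF H] subgroup.m_closed[OF H] subgroup.m_inv_closed[OF H]
lemmas K_closed [simp] = subgroup.one_closed[OF K] subgroup.m_closed[OF K] subgroup.m_inv_closed[OF K]

lemma dc_subset: "g \<in> carrier G \<Longrightarrow> dc g \<subseteq> carrier G"
  by (auto simp: double_coset_def)

lemma dc_self: "g \<in> carrier G \<Longrightarrow> g \<in> dc g"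
proof -
  assume "g \<in> carrier G"
  then have "g = \<one> \<otimes> g \<otimes> \<one>" by simp
  then show ?thesis
    unfolding double_coset_def using subgroup.one_closed[OF H] subgroup.one_closed[OF K] by blast
qed

lemma dc_eq:
  assumes g: "g \<in> carrier G" and x: "x \<in> dc g"
  shows "dc x = dc g"
proof -
  obtain k h where kh: "k \<in> K" "h \<in> H" "x = k \<otimes> g \<otimes> h"
    using x by (auto simp: double_coset_def)
  show ?thesis
  proof
    show "dc x \<subseteq> dc g"
    proof
      fix y assume "y \<in> dc x"
      then obtain k' h' where "k' \<in> K" "h' \<in> H" "y = k' \<otimes> x \<otimes> h'"
        by (auto simp: double_coset_def)
      then have "k' \<otimes> k \<in> K" "h \<otimes> h' \<in> H" "y = (k' \<otimes> k) \<otimes> g \<otimes> (h \<otimes> h')"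
        using kh g by (simp_all add: m_assoc)
      then show "y \<in> dc g" unfolding double_coset_def by blast
    qed
    show "dc g \<subseteq> dc x"
    proof
      fix y assume "y \<in> dc g"
      then obtain k' h' where y: "k' \<in> K" "h' \<in> H" "y = k' \<otimes> g \<otimes> h'"
        by (auto simp: double_coset_def)
      have "k' \<otimes> inv k \<in> K" "inv h \<otimes> h' \<in> H" "y = (k' \<otimes> inv k) \<otimes> x \<otimes> (inv h \<otimes> h')"
        using kh y g by (simp_all add: m_assoc inv_cancel)
      then show "y \<in> dc x" unfolding double_coset_def by blast
    qed
  qed
qed

lemma l_coset_subset_dc: "g \<in> carrier G \<Longrightarrow> x \<in> dc g \<Longrightarrow> lc x \<subseteq> dc g"
proof -
  assume g: "g \<in> carrier G" and x: "x \<in> dc g"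
  then have xc: "x \<in> carrier G" using dc_subset by blast
  have "lc x \<subseteq> dc x"
  proof
    fix y assume "y \<in> lc x"
    then obtain h where "h \<in> H" "y = \<one> \<otimes> x \<otimes> h" using xc by (auto simp: l_coset_def)
    then show "y \<in> dc x" unfolding double_coset_def using subgroup.one_closed[OF K] by blast
  qed
  then show ?thesis using dc_eq[OF g x] by simp
qed

lemma r_coset_subset_dc: "g \<in> carrier G \<Longrightarrow> x \<in> dc g \<Longrightarrow> rc x \<subseteq> dc g"
proof -
  assume g: "g \<in> carrier G" and x: "x \<in> dc g"
  then have xc: "x \<in> carrier G" using dc_subset by blast
  have "rc x \<subseteq> dc x"
  proof
    fix y assume "y \<in> rc x"
    then obtain k where "k \<in> K" "y = k \<otimes> x \<otimes> \<one>" using xc by (auto simp: r_coset_def)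
    then show "y \<in> dc x" unfolding double_coset_def using subgroup.one_closed[OF H] by blast
  qed
  then show ?thesis using dc_eq[OF g x] by simp
qed

text \<open>A coset of a point of a double coset stays inside it. A common label thus yields a
  common point, and double cosets with a common point coincide.\<close>

lemma dc_coset_images_disjoint:
  assumes D: "D \<in> dc ` carrier G" and E: "E \<in> dc ` carrier G" and "D \<noteq> E"
  shows "lc ` D \<inter> lc ` E = {} \<and> rc ` D \<inter> rc ` E = {}"
proof (rule ccontr)
  obtain g g' where g: "g \<in> carrier G" "D = dc g" "g' \<in> carrier G" "E = dc g'" using D E by auto
  assume "\<not> ?thesis"
  then obtain x y where xy: "x \<in> D" "y \<in> E" "lc x = lc y \<or> rc x = rc y" by blast
  then have c: "x \<in> carrier G" "y \<in> carrier G" using g dc_subset by auto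
  then have "x \<in> lc x" "x \<in> rc x" using lcos_self rcos_self H K by auto
  then have "x \<in> E" using xy g l_coset_subset_dc r_coset_subset_dc by blast
  then have "dc x = E" "dc x = D" using dc_eq[OF g(3), of x] dc_eq[OF g(1), of x] g xy by simp_all
  then show False using \<open>D \<noteq> E\<close> by simp
qed

text \<open>For \<open>x = kgh\<close> and \<open>y = k'gh'\<close>, the injective map sending
  \<open>w\<close> to \<open>kwh'\<close> carries \<open>gH\<close> onto \<open>xH\<close> and
  \<open>Kg\<close> onto \<open>Ky\<close>, hence one intersection onto the other.\<close>

lemma card_l_coset_Int_r_coset:
  assumes g: "g \<in> carrier G" and x: "x \<in> dc g" and y: "y \<in> dc g"
  shows "card (lc x \<inter> rc y) = card (lc g \<inter> rc g)"
proof -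
  obtain k h where kh: "k \<in> K" "h \<in> H" "x = k \<otimes> g \<otimes> h" using x by (auto simp: double_coset_def)
  obtain k' h' where kh': "k' \<in> K" "h' \<in> H" "y = k' \<otimes> g \<otimes> h'" using y by (auto simp: double_coset_def)
  have "lc x \<inter> rc y = (\<lambda>w. k \<otimes> w \<otimes> h') ` (lc g \<inter> rc g)"
  proof
    show "lc x \<inter> rc y \<subseteq> (\<lambda>w. k \<otimes> w \<otimes> h') ` (lc g \<inter> rc g)"
    proof
      fix z assume "z \<in> lc x \<inter> rc y"
      then obtain a b where ab: "a \<in> H" "z = x \<otimes> a" "b \<in> K" "z = b \<otimes> y"
        by (auto simp: l_coset_def r_coset_def)
      define w where "w = inv k \<otimes> z \<otimes> inv h'"
      have zc: "z \<in> carrier G" using ab kh g by simp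
      have "w = g \<otimes> (h \<otimes> a \<otimes> inv h')" using ab(1,2) kh kh' g
        by (simp add: w_def m_assoc inv_cancel)
      moreover have "w = (inv k \<otimes> b \<otimes> k') \<otimes> g" using ab(3,4) kh kh' g
        by (simp add: w_def m_assoc inv_cancel)
      moreover have "h \<otimes> a \<otimes> inv h' \<in> H" "inv k \<otimes> b \<otimes> k' \<in> K" using ab kh kh' by simp_all
      ultimately have "w \<in> lc g \<inter> rc g" unfolding l_coset_def r_coset_def by blast
      moreover have "z = k \<otimes> w \<otimes> h'" using kh kh' zc
        by (simp add: w_def m_assoc inv_cancel)
      ultimately show "z \<in> (\<lambda>w. k \<otimes> w \<otimes> h') ` (lc g \<inter> rc g)" by blast
    qed
    show "(\<lambda>w. k \<otimes> w \<otimes> h') ` (lc g \<inter> rc g) \<subseteq> lc x \<inter> rc y"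
    proof (rule image_subsetI)
      fix w assume "w \<in> lc g \<inter> rc g"
      then obtain a b where ab: "a \<in> H" "w = g \<otimes> a" "b \<in> K" "w = b \<otimes> g"
        by (auto simp: l_coset_def r_coset_def)
      have "k \<otimes> w \<otimes> h' = x \<otimes> (inv h \<otimes> a \<otimes> h')" using ab(1,2) kh kh' g
        by (simp add: m_assoc inv_cancel)
      moreover have "k \<otimes> w \<otimes> h' = (k \<otimes> b \<otimes> inv k') \<otimes> y" using ab(3,4) kh kh' g
        by (simp add: m_assoc inv_cancel)
      moreover have "inv h \<otimes> a \<otimes> h' \<in> H" "k \<otimes> b \<otimes> inv k' \<in> K" using ab kh kh' by simp_all
      ultimately show "k \<otimes> w \<otimes> h' \<in> lc x \<inter> rc y" unfolding l_coset_def r_coset_def by blast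
    qed
  qed
  moreover have "inj_on (\<lambda>w. k \<otimes> w \<otimes> h') (lc g \<inter> rc g)"
  proof (rule inj_onI)
    fix v w assume "v \<in> lc g \<inter> rc g" "w \<in> lc g \<inter> rc g" and eq: "k \<otimes> v \<otimes> h' = k \<otimes> w \<otimes> h'"
    then have "v \<in> carrier G" "w \<in> carrier G"
      using l_coset_subset_G[OF subgroup.subset[OF H] g] by auto
    with eq show "v = w" using kh kh' by simp
  qed
  ultimately show ?thesis by (simp add: card_image)
qed

text \<open>Identifies the fibres of the pair of labels as coset intersections, whose size is
  already known to be constant.\<close>

lemma dc_fiber:
  assumes g: "g \<in> carrier G" and x: "x \<in> dc g" and y: "y \<in> dc g"
  shows "{z \<in> dc g. lc z = lc x \<and> rc z = rc y} = lc x \<inter> rc y"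
proof -
  have c: "x \<in> carrier G" "y \<in> carrier G" using dc_subset g x y by auto
  show ?thesis
    using mem_l_coset_iff[OF H c(1)] mem_r_coset_iff[OF K c(2)] dc_subset[OF g]
      l_coset_subset_dc[OF g x] by blast
qed

lemma card_l_coset: "x \<in> carrier G \<Longrightarrow> card (lc x) = card H"
  using l_card_cosets_equal[OF _ subgroup.subset[OF H] fin] by (metis lcosets_eq_image imageI)

lemma card_r_coset: "x \<in> carrier G \<Longrightarrow> card (rc x) = card H"
  using card_rcosets_equal[OF _ subgroup.subset[OF K]] card_eq by (metis rcosets_eq_image imageI)

text \<open>The right cosets in \<open>KgH\<close> cut the left coset \<open>gH\<close> into pieces
  of equal size.\<close>

lemma card_rc_image_times:
  assumes g: "g \<in> carrier G"
  shows "card (rc ` dc g) * card (lc g \<inter> rc g) = card H"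
proof -
  have finD: "finite (dc g)" using dc_subset[OF g] fin finite_subset by blast
  have sub: "lc g \<subseteq> dc g" by (rule l_coset_subset_dc[OF g dc_self[OF g]])
  have "lc g = (\<Union>C\<in>rc ` dc g. lc g \<inter> C)"
    using sub rcos_self[OF _ K] dc_subset[OF g] by blast
  then have "card (lc g) = card (\<Union>C\<in>rc ` dc g. lc g \<inter> C)" by simp
  also have "\<dots> = (\<Sum>C\<in>rc ` dc g. card (lc g \<inter> C))"
  proof (rule card_UN_disjoint)
    show "\<forall>C\<in>rc ` dc g. finite (lc g \<inter> C)" using sub finD finite_subset by blast
    show "\<forall>C\<in>rc ` dc g. \<forall>C'\<in>rc ` dc g. C \<noteq> C' \<longrightarrow> (lc g \<inter> C) \<inter> (lc g \<inter> C') = {}"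
      using rcos_disjoint[OF K] dc_subset[OF g]
      unfolding rcosets_eq_image pairwise_def disjnt_def by blast
  qed (use finD in simp)
  also have "\<dots> = (\<Sum>C\<in>rc ` dc g. card (lc g \<inter> rc g))"
    by (rule sum.cong) (use card_l_coset_Int_r_coset[OF g dc_self[OF g]] in auto)
  finally show ?thesis using card_l_coset[OF g] by simp
qed

text \<open>The mirror image: the left cosets in \<open>KgH\<close> cut \<open>Kg\<close>, which has
  \<open>card H\<close> elements because the two subgroups have equal order.\<close>

lemma card_lc_image_times:
  assumes g: "g \<in> carrier G"
  shows "card (lc ` dc g) * card (lc g \<inter> rc g) = card H"
proof -
  have finD: "finite (dc g)" using dc_subset[OF g] fin finite_subset by blast
  have sub: "rc g \<subseteq> dc g" by (rule r_coset_subset_dc[OF g dc_self[OF g]])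
  have "rc g = (\<Union>C\<in>lc ` dc g. C \<inter> rc g)"
    using sub lcos_self[OF _ H] dc_subset[OF g] by blast
  then have "card (rc g) = card (\<Union>C\<in>lc ` dc g. C \<inter> rc g)" by simp
  also have "\<dots> = (\<Sum>C\<in>lc ` dc g. card (C \<inter> rc g))"
  proof (rule card_UN_disjoint)
    show "\<forall>C\<in>lc ` dc g. finite (C \<inter> rc g)" using sub finD finite_subset by blast
    show "\<forall>C\<in>lc ` dc g. \<forall>C'\<in>lc ` dc g. C \<noteq> C' \<longrightarrow> (C \<inter> rc g) \<inter> (C' \<inter> rc g) = {}"
      using lcos_disjoint[OF H] dc_subset[OF g]
      unfolding lcosets_eq_image by blast
  qed (use finD in simp)
  also have "\<dots> = (\<Sum>C\<in>lc ` dc g. card (lc g \<inter> rc g))"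
    by (rule sum.cong) (use card_l_coset_Int_r_coset[OF g _ dc_self[OF g]] in auto)
  finally show ?thesis using card_r_coset[OF g] by simp
qed

lemma card_H_pos: "0 < card H"
  using subgroup.finite_imp_card_positive[OF H fin] .

text \<open>Comparing the two products equal to \<open>card H\<close> shows that there are as many
  right as left cosets, say \<open>d\<close>, with intersections of size
  \<open>m = card H / d\<close>. The block count \<open>d! m^d\<close> is then \<open>d!/d^d\<close>
  times \<open>(d m)^d\<close>.\<close>

lemma card_double_transversals_dc:
  assumes g: "g \<in> carrier G"
  shows "real (card (double_transversals lc rc (dc g))) =
    fact_ratio (card (lc ` dc g)) * real (card H) ^ card (lc ` dc g)"
proof -
  let ?d = "card (lc ` dc g)" and ?m = "card (lc g \<inter> rc g)"
  have dm: "?d * ?m = card H" by (rule card_lc_image_times[OF g])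
  have m: "0 < ?m" "0 < ?d" using dm card_H_pos by (auto intro: Nat.gr0I)
  have "card (rc ` dc g) = ?d"
    using card_rc_image_times[OF g] dm m by (metis mult_right_cancel less_not_refl)
  moreover have "finite (dc g)" using dc_subset[OF g] fin finite_subset by blast
  ultimately have "card (double_transversals lc rc (dc g)) = fact ?d * ?m ^ ?d"
    using dc_fiber[OF g] card_l_coset_Int_r_coset[OF g]
    by (intro card_double_transversals_complete) auto
  then have "real (card (double_transversals lc rc (dc g))) = fact ?d * real ?m ^ ?d" by simp
  also have "\<dots> = fact_ratio ?d * (real ?d * real ?m) ^ ?d"
    using m by (simp add: fact_ratio_def power_mult_distrib)
  also have "real ?d * real ?m = real (card H)" using dm by (metis of_nat_mult)
  finally show ?thesis .
qed

section \<open>From one double coset to the whole group\<close>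

lemma Union_dc: "\<Union>(dc ` carrier G) = carrier G"
  using dc_subset dc_self by blast

lemma subgroup_index_eq_sum: "subgroup_index G H = (\<Sum>D\<in>dc ` carrier G. card (lc ` D))"
proof -
  have "lcosets H = (\<Union>D\<in>dc ` carrier G. lc ` D)"
    unfolding lcosets_eq_image using Union_dc by blast
  then have "subgroup_index G H = card (\<Union>D\<in>dc ` carrier G. lc ` D)"
    by (simp add: subgroup_index_def)
  also have "\<dots> = (\<Sum>D\<in>dc ` carrier G. card (lc ` D))"
  proof (rule card_UN_disjoint)
    show "\<forall>D\<in>dc ` carrier G. finite (lc ` D)"
      using dc_subset fin by (auto intro!: finite_imageI dest: finite_subset)
  qed (use fin dc_coset_images_disjoint in auto)
  finally show ?thesis .
qed

theorem P_DT_eq_prod: "P_DT G H K = (\<Prod>D\<in>dc ` carrier G. fact_ratio (card (lc ` D)))"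
proof -
  have "real (card (DT G H K)) = real (card (double_transversals lc rc (\<Union>(dc ` carrier G))))"
    by (simp add: DT_eq_double_transversals[OF H K] Union_dc)
  also have "\<dots> = (\<Prod>D\<in>dc ` carrier G. real (card (double_transversals lc rc D)))"
    using fin dc_coset_images_disjoint by (subst card_double_transversals_Union) auto
  also have "\<dots> = (\<Prod>D\<in>dc ` carrier G. fact_ratio (card (lc ` D)) * real (card H) ^ card (lc ` D))"
    by (rule prod.cong) (use card_double_transversals_dc in auto)
  \<comment> \<open>The exponents add up to the index, so this power of \<open>card H\<close> is
    exactly the denominator of \<open>P_DT\<close>.\<close>
  also have "\<dots> = (\<Prod>D\<in>dc ` carrier G. fact_ratio (card (lc ` D))) * real (card H) ^ subgroup_index G H"
    by (simp add: prod.distrib subgroup_index_eq_sum power_sum)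
  finally show ?thesis using card_H_pos by (simp add: P_DT_def)
qed

section \<open>Effect of non-normality and conjugacy on the factors\<close>

lemma l_coset_eq_r_coset:
  assumes g: "g \<in> carrier G" and d: "card (lc ` dc g) = 1"
  shows "lc g = rc g"
proof -
  have m: "card (lc g \<inter> rc g) = card H" using card_lc_image_times[OF g] d by simp
  have "finite (lc g)" "finite (rc g)"
    using l_coset_subset_G[OF subgroup.subset[OF H] g] r_coset_subset_G[OF subgroup.subset[OF K] g]
      fin finite_subset by auto
  then have "lc g \<inter> rc g = lc g" "lc g \<inter> rc g = rc g"
    using m card_l_coset[OF g] card_r_coset[OF g] by (simp_all add: card_subset_eq)
  then show ?thesis by simp
qed

text \<open>If every double coset were a single left coset, then \<open>gH = Kg\<close> for all
  \<open>g\<close>. Taking \<open>g = 1\<close> gives \<open>H = K\<close>, and then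
  \<open>H\<close> would be normal.\<close>

lemma ex_large_dc:
  assumes "\<not> H \<lhd> G"
  shows "\<exists>g\<in>carrier G. 2 \<le> card (lc ` dc g)"
proof (rule ccontr)
  assume "\<not> ?thesis"
  then have "card (lc ` dc g) = 1" if "g \<in> carrier G" for g
    using that card_lc_image_times[OF that] card_H_pos
    by (metis One_nat_def Suc_1 Suc_leI le_neq_implies_less mult_0 neq0_conv not_less)
  then have eq: "lc g = rc g" if "g \<in> carrier G" for g using l_coset_eq_r_coset that by blast
  from eq[of \<one>] have "H = K"
    using subgroup.subset[OF H] subgroup.subset[OF K] by (simp add: lcos_mult_one coset_mult_one)
  then show False using assms eq normalI[OF H] by simp
qed

text \<open>Conjugation by \<open>g\<close> turns \<open>Kg\<close> into \<open>gH\<close>, so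
  \<open>KgH\<close> collapses to the single left coset \<open>gH\<close>.\<close>

lemma card_lc_dc_conjugator:
  assumes g: "g \<in> carrier G" and conj: "K = g <# (H #> inv g)"
  shows "card (lc ` dc g) = 1"
proof -
  have "lc x = lc g" if x: "x \<in> dc g" for x
  proof -
    obtain k h where kh: "k \<in> K" "h \<in> H" "x = k \<otimes> g \<otimes> h"
      using x by (auto simp: double_coset_def)
    obtain a where a: "a \<in> H" "k = g \<otimes> (a \<otimes> inv g)"
      using kh(1) unfolding conj by (auto simp: l_coset_def r_coset_def)
    have "x = g \<otimes> (a \<otimes> h)" using a kh g by (simp add: m_assoc)
    then have "x \<in> lc g" using a kh by (auto simp: l_coset_def)
    then show ?thesis
      using mem_l_coset_iff[OF H g] x dc_subset[OF g] by blast
  qed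
  then have "lc ` dc g = {lc g}" using dc_self[OF g] by blast
  then show ?thesis by simp
qed

lemma P_DT_bounds:
  assumes "conjugate_subgroups G H K" "\<not> H \<lhd> G"
  shows "fact_ratio (subgroup_index G H - 1) \<le> P_DT G H K" "P_DT G H K \<le> 1 / 2"
proof -
  let ?\<D> = "dc ` carrier G" and ?d = "\<lambda>D. card (lc ` D)"
  have finD: "finite ?\<D>" using fin by simp
  obtain g where g: "g \<in> carrier G" "?d (dc g) = 1"
    using assms(1) card_lc_dc_conjugator unfolding conjugate_subgroups_def by blast
  \<comment> \<open>The double coset of the conjugator has factor 1 and is set aside first; merging
    it with the others would only give the weaker bound \<open>fact_ratio n\<close>.\<close>
  have "fact_ratio (\<Sum>D\<in>?\<D> - {dc g}. ?d D) \<le> (\<Prod>D\<in>?\<D> - {dc g}. fact_ratio (?d D))"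
    by (rule fact_ratio_sum_le) (use finD in simp)
  moreover have "(\<Sum>D\<in>?\<D> - {dc g}. ?d D) = subgroup_index G H - 1"
    using finD g by (simp add: subgroup_index_eq_sum sum_diff1_nat)
  moreover have "P_DT G H K = fact_ratio (?d (dc g)) * (\<Prod>D\<in>?\<D> - {dc g}. fact_ratio (?d D))"
    unfolding P_DT_eq_prod using finD g by (intro prod.remove) auto
  moreover have "fact_ratio 1 = 1" by (simp add: fact_ratio_def)
  ultimately show "fact_ratio (subgroup_index G H - 1) \<le> P_DT G H K" using g(2) by simp
  obtain x where x: "x \<in> carrier G" "2 \<le> ?d (dc x)" using ex_large_dc[OF assms(2)] by blast
  have "P_DT G H K = fact_ratio (?d (dc x)) * (\<Prod>D\<in>?\<D> - {dc x}. fact_ratio (?d D))"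
    unfolding P_DT_eq_prod using finD x by (intro prod.remove) auto
  also have "\<dots> \<le> 1 / 2 * 1"
  proof (rule mult_mono)
    show "(\<Prod>D\<in>?\<D> - {dc x}. fact_ratio (?d D)) \<le> 1"
      by (rule prod_le_1) (simp add: fact_ratio_le_1 fact_ratio_pos less_imp_le)
    show "0 \<le> (\<Prod>D\<in>?\<D> - {dc x}. fact_ratio (?d D))"
      by (rule prod_nonneg) (simp add: fact_ratio_pos less_imp_le)
  qed (use fact_ratio_le_half[OF x(2)] in simp_all)
  finally show "P_DT G H K \<le> 1 / 2" by simp
qed

end

lemma conj_nonnormal_pair_bounds:
  assumes "conj_nonnormal_pair G H K n"
  shows "fact (n - 1) / real (n - 1) ^ (n - 1) \<le> P_DT G H K \<and> P_DT G H K \<le> 1 / 2"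
proof -
  have G: "group G" "finite (carrier G)" "subgroup H G" "subgroup K G"
    "conjugate_subgroups G H K" "\<not> H \<lhd> G"
    and n: "subgroup_index G H = n" "subgroup_index G K = n"
    using assms by (auto simp: conj_nonnormal_pair_def)
  interpret group G by (rule G)
  \<comment> \<open>By Lagrange, equal index forces equal order, which the locale asks for.\<close>
  have "n * card H = order G" "n * card K = order G"
    using l_lagrange[OF G(2,3)] l_lagrange[OF G(2,4)] n by (simp_all add: subgroup_index_def)
  moreover have "0 < order G" using G(2) order_gt_0_iff_finite by blast
  ultimately have "card H = card K" by (metis mult_left_cancel mult_0 less_not_refl)
  then interpret double_coset_pair G H K
    using G by (intro double_coset_pair.intro double_coset_pair_axioms.intro)
  show ?thesis
    using P_DT_bounds[OF G(5,6)] n by (simp add: fact_ratio_def)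
qed

section \<open>An extremal example\<close>

text \<open>The symmetric group on three letters as \<open>\<int>/3 \<rtimes> \<int>/2\<close>; the number \<open>a + 3 e\<close> with
  \<open>a < 3\<close>, \<open>e < 2\<close> encodes the pair \<open>(a, e)\<close>, so the elements below 3 are the rotations.\<close>

definition s3_mult :: "nat \<Rightarrow> nat \<Rightarrow> nat" where
  "s3_mult x y = (x + (if x < 3 then y else 2 * y)) mod 3 + (if (x < 3) = (y < 3) then 0 else 3)"

definition s3 :: "nat monoid" where
  "s3 = \<lparr>carrier = {..<6}, mult = s3_mult, one = 0\<rparr>"

text \<open>Associativity is checked by evaluation. In \<open>s3_mult\<close>, doubling
  \<open>y\<close> negates its rotation part, because 2 is -1 modulo 3 and the encoding's summand
  \<open>3 e\<close> vanishes modulo 3.\<close>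

lemma group_s3: "group s3"
proof (rule groupI)
  have assoc: "\<forall>x\<in>{0,1,2,3,4,5}. \<forall>y\<in>{0,1,2,3,4,5}. \<forall>z\<in>{0,1,2,3,4,5}.
      s3_mult (s3_mult x y) z = s3_mult x (s3_mult y z)"
    by code_simp
  have carrier: "carrier s3 = {0,1,2,3,4,5}" and mult: "mult s3 = s3_mult"
    by (auto simp: s3_def)
  fix x y z assume "x \<in> carrier s3" "y \<in> carrier s3" "z \<in> carrier s3"
  then show "x \<otimes>\<^bsub>s3\<^esub> y \<otimes>\<^bsub>s3\<^esub> z = x \<otimes>\<^bsub>s3\<^esub> (y \<otimes>\<^bsub>s3\<^esub> z)"
    unfolding carrier mult by (rule assoc[rule_format])
next
  fix x assume "x \<in> carrier s3"
  then have "x \<in> {0,1,2,3,4,5}" by (auto simp: s3_def)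
  \<comment> \<open>A reflection is its own inverse. A rotation \<open>x\<close> has inverse
    \<open>3 - x\<close>, reduced modulo 3 so that 0 is sent to 0.\<close>
  then have "s3_mult (if x < 3 then (3 - x) mod 3 else x) x = 0 \<and> (if x < 3 then (3 - x) mod 3 else x) < 6"
    by (auto simp: s3_mult_def)
  then show "\<exists>y\<in>carrier s3. y \<otimes>\<^bsub>s3\<^esub> x = \<one>\<^bsub>s3\<^esub>" by (auto simp: s3_def)
next
  fix x y assume "x \<in> carrier s3" "y \<in> carrier s3"
  have "(x + (if x < 3 then y else 2 * y)) mod 3 < 3" by simp
  then show "x \<otimes>\<^bsub>s3\<^esub> y \<in> carrier s3" by (auto simp: s3_def s3_mult_def)
next
  fix x assume "x \<in> carrier s3"
  then have "x \<in> {0,1,2,3,4,5}" by (auto simp: s3_def)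
  then show "\<one>\<^bsub>s3\<^esub> \<otimes>\<^bsub>s3\<^esub> x = x" by (auto simp: s3_def s3_mult_def)
qed (simp add: s3_def)

lemma conj_nonnormal_pair_s3: "conj_nonnormal_pair s3 {0, 3} {0, 3} 3"
proof -
  interpret group s3 by (rule group_s3)
  have inv3: "inv\<^bsub>s3\<^esub> 3 = 3" by (rule inv_equality) (auto simp: s3_def s3_mult_def)
  have inv0: "inv\<^bsub>s3\<^esub> 0 = 0" using inv_one by (simp add: s3_def)
  have sub: "subgroup {0, 3} s3"
    by (rule subgroupI) (auto simp: inv3 inv0, auto simp: s3_def s3_mult_def)
  have "\<not> {0, 3} \<lhd> s3"
  proof
    assume "{0, 3} \<lhd> s3"
    \<comment> \<open>The right coset of 1 is \<open>{1, 5}\<close>, whereas the left coset is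
      \<open>{1, 4}\<close>.\<close>
    then have "{0, 3} #>\<^bsub>s3\<^esub> 1 = 1 <#\<^bsub>s3\<^esub> {0, 3}"
      using normal.coset_eq by (fastforce simp: s3_def)
    then show False by (auto simp: r_coset_def l_coset_def s3_def s3_mult_def)
  qed
  moreover have "carrier s3 = {0,1,2,3,4,5}" by (auto simp: s3_def)
  then have "lcosets\<^bsub>s3\<^esub> {0, 3} = {{0, 3}, {1, 4}, {2, 5}}"
    unfolding LCOSETS_def l_coset_def by (auto simp: s3_def s3_mult_def)
  then have "subgroup_index s3 {0, 3} = 3"
    by (simp add: subgroup_index_def doubleton_eq_iff)
  moreover have "conjugate_subgroups s3 {0, 3} {0, 3}"
  proof -
    \<comment> \<open>Both subgroups are the same, so the identity serves as conjugator.\<close>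
    have "{0, 3} = 0 <#\<^bsub>s3\<^esub> ({0, 3} #>\<^bsub>s3\<^esub> inv\<^bsub>s3\<^esub> 0)"
      unfolding inv0 by (simp add: l_coset_def r_coset_def s3_def s3_mult_def)
    then show ?thesis unfolding conjugate_subgroups_def
      by (rule bexI) (simp add: s3_def)
  qed
  ultimately show ?thesis
    using sub group_s3 by (simp add: conj_nonnormal_pair_def s3_def)
qed

text \<open>At \<open>n = 3\<close> the lower bound is \<open>2!/2^2 = 1/2\<close> and meets the
  upper bound.\<close>

lemma P_DT_index_3:
  assumes "conj_nonnormal_pair G H K 3"
  shows "P_DT G H K = 1 / 2"
  using conj_nonnormal_pair_bounds[OF assms] by simp

theorem corollary3p10:
  shows "(\<forall>(G :: ('a, 'b) monoid_scheme) H K n. conj_nonnormal_pair G H K n \<longrightarrow>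
            fact (n - 1) / real (n - 1) ^ (n - 1) \<le> P_DT G H K \<and> P_DT G H K \<le> 1 / 2)
       \<and> (\<exists>(G :: nat monoid) H K n. conj_nonnormal_pair G H K n \<and>
            P_DT G H K = fact (n - 1) / real (n - 1) ^ (n - 1))
       \<and> (\<exists>(G :: nat monoid) H K n. conj_nonnormal_pair G H K n \<and> P_DT G H K = 1 / 2)
       \<and> (\<forall>(G :: ('a, 'b) monoid_scheme) H K. conj_nonnormal_pair G H K 3 \<longrightarrow>
            P_DT G H K = 1 / 2)"
proof (intro conjI allI impI)
  show "\<exists>(G :: nat monoid) H K n. conj_nonnormal_pair G H K n \<and>
      P_DT G H K = fact (n - 1) / real (n - 1) ^ (n - 1)"
    using conj_nonnormal_pair_s3 P_DT_index_3[OF conj_nonnormal_pair_s3]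
    by (intro exI[of _ s3] exI[of _ "{0, 3}"] exI[of _ 3]) simp
  show "\<exists>(G :: nat monoid) H K n. conj_nonnormal_pair G H K n \<and> P_DT G H K = 1 / 2"
    using conj_nonnormal_pair_s3 P_DT_index_3[OF conj_nonnormal_pair_s3] by blast
qed (use conj_nonnormal_pair_bounds P_DT_index_3 in blast)+

end
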